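(* If $r$ is a positive odd integer and $N = \dfrac{2^{3r+2}-5}{9}$, then the Collatz sequence starting with $N$ reaches $1$ in $3r+2$ steps, i.e. $N$ is a positive integer and $T^{3r+2}(N)=1$.
   Context: The Collatz map $T$ on positive integers is $T(n)=n/2$ if $n$ is even and $T(n)=(3n+1)/2$ if $n$ is odd. The Collatz sequence starting with $N$ is $N, T(N), T^2(N),\dots$, continued indefinitely. One step is one application of $T$; $N$ reaches a value $m$ in $s$ steps if $T^s(N)=m$ (this is not required to be the first occurrence of $m$). *)

theory Defs
  imports Complex_Main
begin

(* The map of interest lives on the positive integers, which it preserves;
   the junk value at 0 is collatz 0 = 0. *)
definition collatz :: "nat \<Rightarrow> nat" where
  "collatz n = (if even n then n div 2 else (3 * n + 1) div 2)"

end

(* With r odd, 2^(3r+2) = 5 (mod 9), so N is an integer.  N is odd and maps to (2^(3r+1) - 1)/3,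
   which is odd again and maps to 2^(3r); the remaining 3r steps are halvings. *)
theory Submission imports Defs begin

text \<open>If 9N + 5 = 4q, two odd steps from N land exactly on q
  (\<open>collatz_collatz_eq\<close>). For q = 2^(3r) only halvings remain
  (\<open>collatz_funpow_power_two\<close>). Odd r makes N an integer, as 64 = 1 mod 9
  (\<open>power_two_cong_5_mod_9\<close>).\<close>

lemma collatz_funpow_power_two: "(collatz ^^ k) (2 ^ k) = 1"
  by (induction k) (simp_all add: collatz_def funpow_Suc_right del: funpow.simps(2))

lemma power_two_cong_5_mod_9:
  assumes "odd r"
  shows "\<exists>N::nat. 9 * N + 5 = 2 ^ (3 * r + 2)"
proof -
  obtain k where r: "r = 2 * k + 1" using assms by (elim oddE)
  have "\<exists>N::nat. 9 * N + 5 = 32 * 64 ^ k"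
  proof (induction k)
    case 0
    show ?case by (rule exI[of _ 3]) simp
  next
    case (Suc k)
    then obtain N :: nat where "9 * N + 5 = 32 * 64 ^ k" by blast
    \<comment> \<open>35 = (64 * 5 - 5) / 9.\<close>
    then have "9 * (64 * N + 35) + 5 = 32 * 64 ^ Suc k" by simp
    then show ?case by blast
  qed
  moreover have "(2::nat) ^ (3 * r + 2) = 32 * 64 ^ k"
    by (simp add: r power_add power_mult)
  ultimately show ?thesis by simp
qed

text \<open>Two odd steps send N to ((9N + 3)/2 + 1)/2 = (9N + 5)/4.\<close>

lemma collatz_collatz_eq:
  assumes "9 * N + 5 = 4 * q"
  shows "collatz (collatz N) = q"
proof -
  have "odd N" using assms by presburger
  then have M: "2 * collatz N = 3 * N + 1" by (simp add: collatz_def)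
  then have q: "3 * collatz N + 1 = 2 * q" using assms by linarith
  then have "odd (collatz N)" by presburger
  then show ?thesis using q by (simp add: collatz_def[of "collatz N"])
qed

theorem corollary4:
  fixes r :: nat
  assumes "r > 0" and "odd r"
  shows "\<exists>N::nat. real N = (2 ^ (3 * r + 2) - 5) / 9 \<and> N > 0 \<and> (collatz ^^ (3 * r + 2)) N = 1"
proof -
  obtain N :: nat where N: "9 * N + 5 = 2 ^ (3 * r + 2)"
    using power_two_cong_5_mod_9[OF assms(2)] by blast
  have "real (9 * N + 5) = 2 ^ (3 * r + 2)" unfolding N by simp
  then have "real N = (2 ^ (3 * r + 2) - 5) / 9" by simp
  moreover have N4: "9 * N + 5 = 4 * 2 ^ (3 * r)" using N by simp
  \<comment> \<open>\<open>N = 0\<close> would make 4 divide 5.\<close>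
  then have "N > 0" by presburger
  moreover have "collatz (collatz N) = 2 ^ (3 * r)"
    using N4 by (rule collatz_collatz_eq)
  then have "(collatz ^^ (3 * r + 2)) N = 1"
    using collatz_funpow_power_two[of "3 * r"]
    \<comment> \<open>Keeping the sum \<open>3 * r + 2\<close> intact lets \<open>funpow_add\<close>
      put the two odd steps innermost.\<close>
    by (simp add: funpow_add numeral_2_eq_2[THEN arg_cong, of "\<lambda>n. collatz ^^ n"] del: add_2_eq_Suc add_2_eq_Suc')
  ultimately show ?thesis by blast
qed

end
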